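(* Let $H$ be a separable infinite-dimensional complex Hilbert space with orthonormal basis $E=(e_n)_{n\in\mathbb{N}}$. Then the closure, in the Arens–Mackey topology, of the (real) affine hull of $\pi(\mathrm{FS}_{\mathbb{N}})$ is the set of all bounded operators with real matrix coefficients: $\overline{\mathrm{aff}}^{M}\,\pi(\mathrm{FS}_{\mathbb{N}})=B_{\mathbb{R}}(H)$.
   Context: $\mathrm{FS}_{\mathbb{N}}$ is the group of bijections $\rho:\mathbb{N}\to\mathbb{N}$ with $\rho(n)=n$ for all but finitely many $n$, and $\pi(\rho)\in B(H)$ is defined by $\pi(\rho)e_n=e_{\rho(n)}$. $B_{\mathbb{R}}(H)=\{a\in B(H): \langle ae_k,e_m\rangle\in\mathbb{R}\text{ for all } m,k\}$. The affine hull $\mathrm{aff}(S)$ is the set of finite sums $\sum_j t_j s_j$ with $s_j\in S$, $t_j\in\mathbb{R}$, $\sum_j t_j=1$. The Arens–Mackey topology $M$ is the Mackey topology $\tau(B(H),B(H)_* )$, where $B(H)_*$ is the predual of $B(H)$. $\overline{\mathrm{aff}}^{M}$ denotes the $M$-closure of the affine hull. *)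

theory Defs
  imports "HOL-Analysis.Analysis"
begin

(* A complex Hilbert space, presented as a real Hilbert space of the library with compatible
   complex structure. The norm is the one of the real inner product, so
   norm x ^ 2 = Re (cinner x x) = cinner x x. The inner product is linear in its first argument. *)
class complex_hilbert_space = real_inner + complete_space +
  fixes scaleC :: "complex \<Rightarrow> 'a \<Rightarrow> 'a"  (infixr \<open>*\<^sub>C\<close> 75)
    and cinner :: "'a \<Rightarrow> 'a \<Rightarrow> complex"
  assumes scaleC_add_right: "c *\<^sub>C (x + y) = c *\<^sub>C x + c *\<^sub>C y"
    and scaleC_add_left: "(c + d) *\<^sub>C x = c *\<^sub>C x + d *\<^sub>C x"
    and scaleC_scaleC: "c *\<^sub>C d *\<^sub>C x = (c * d) *\<^sub>C x"
    and scaleR_scaleC: "r *\<^sub>R x = complex_of_real r *\<^sub>C x"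
    and cinner_commute: "cinner x y = cnj (cinner y x)"
    and cinner_add_left: "cinner (x + y) z = cinner x z + cinner y z"
    and cinner_scaleC_left: "cinner (c *\<^sub>C x) y = c * cinner x y"
    and inner_eq_Re_cinner: "inner x y = Re (cinner x y)"

global_interpretation complex_vector: vector_space "scaleC :: complex \<Rightarrow> 'a \<Rightarrow> 'a::complex_hilbert_space"
  defines cspan = complex_vector.span
proof
  show "1 *\<^sub>C x = x" for x :: 'a
    using scaleR_scaleC[of 1 x] by simp
qed (simp_all add: scaleC_add_right scaleC_add_left scaleC_scaleC)

(* Being indexed by nat, such a basis forces the space to be separable and infinite-dimensional. *)
definition orthonormal_basis :: "(nat \<Rightarrow> 'h::complex_hilbert_space) \<Rightarrow> bool" where
  "orthonormal_basis e \<longleftrightarrow>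
     (\<forall>m n. cinner (e m) (e n) = (if m = n then 1 else 0)) \<and> closure (cspan (range e)) = UNIV"

(* B(H), as a set of bounded real-linear maps, so that the library's real vector space
   structure is available. *)
definition BH :: "('h::complex_hilbert_space \<Rightarrow>\<^sub>L 'h) set" where
  "BH = {a. \<forall>c x. blinfun_apply a (c *\<^sub>C x) = c *\<^sub>C blinfun_apply a x}"

(* The predual of B(H), as functionals restricted to B(H). Under the trace duality
   a \<mapsto> tr (a t), the functional given by x and y is the one of the trace class operator
   t = (\<Sum>n. \<langle>-, y n\<rangle> x n), and every trace class operator has this form. *)
definition predual_BH :: "(('h::complex_hilbert_space \<Rightarrow>\<^sub>L 'h) \<Rightarrow> complex) set" where
  "predual_BH = {(\<lambda>a\<in>BH. \<Sum>n. cinner (blinfun_apply a (x n)) (y n)) | x y :: nat \<Rightarrow> 'h.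
      summable (\<lambda>n. (norm (x n))\<^sup>2) \<and> summable (\<lambda>n. (norm (y n))\<^sup>2)}"

(* In the next three definitions X is (the carrier of) a vector space and Y a vector space of
   linear functionals on X, extended by undefined outside X. *)

(* sigma(Y, X) *)
definition weak_topology_on_functionals :: "'a set \<Rightarrow> ('a \<Rightarrow> complex) set \<Rightarrow> ('a \<Rightarrow> complex) topology" where
  "weak_topology_on_functionals X Y = subtopology (product_topology (\<lambda>_. euclidean) X) Y"

definition absolutely_convex :: "'a set \<Rightarrow> ('a \<Rightarrow> complex) set \<Rightarrow> bool" where
  "absolutely_convex X K \<longleftrightarrow>
     (\<forall>f\<in>K. \<forall>g\<in>K. \<forall>s t. cmod s + cmod t \<le> 1 \<longrightarrow> (\<lambda>a\<in>X. s * f a + t * g a) \<in> K)"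

(* tau(X, Y): uniform convergence on the absolutely convex sigma(Y, X)-compact sets K. As K is
   compact, the generating sets are the open balls of the seminorms sup {|f x| : f in K}. *)
definition mackey_topology :: "'a::ab_group_add set \<Rightarrow> ('a \<Rightarrow> complex) set \<Rightarrow> 'a topology" where
  "mackey_topology X Y = topology_generated_by
     {{b \<in> X. \<forall>f\<in>K. cmod (f (b - a)) < r} | a K r.
        a \<in> X \<and> r > 0 \<and> absolutely_convex X K \<and> compactin (weak_topology_on_functionals X Y) K}"

definition arens_mackey :: "('h::complex_hilbert_space \<Rightarrow>\<^sub>L 'h) topology" where
  "arens_mackey = mackey_topology BH predual_BH"

definition FS :: "(nat \<Rightarrow> nat) set" where
  "FS = {\<rho>. bij \<rho> \<and> finite {n. \<rho> n \<noteq> n}}"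

definition perm_op :: "(nat \<Rightarrow> 'h::complex_hilbert_space) \<Rightarrow> (nat \<Rightarrow> nat) \<Rightarrow> ('h \<Rightarrow>\<^sub>L 'h)" where
  "perm_op e \<rho> = (THE a. a \<in> BH \<and> (\<forall>n. blinfun_apply a (e n) = e (\<rho> n)))"

definition BH_real :: "(nat \<Rightarrow> 'h::complex_hilbert_space) \<Rightarrow> ('h \<Rightarrow>\<^sub>L 'h) set" where
  "BH_real e = {a \<in> BH. \<forall>m k. cinner (blinfun_apply a (e k)) (e m) \<in> \<real>}"

end

theory Submission
  imports Defs
begin

text \<open>
  Matrix coefficients belong to the predual, so having real ones is a Mackey closed condition.
  For the other inclusion, suppose that \<open>a\<close> has real matrix coefficients but is not in the Mackey closure of the affine hull \<open>A\<close>. Then some absolutely convex weakly compact set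
  \<open>K\<close> of the predual has the property that every \<open>b \<in> A\<close> admits \<open>f \<in> K\<close> with \<open>Re (f (b - a)) \<ge> 1\<close>;
  by a minimax argument one \<open>f\<close> works for all \<open>b\<close>. As \<open>A\<close> is affine, \<open>Re f\<close> is constant
  on \<open>A\<close>. Let \<open>\<tau> k i\<close> be the real part of \<open>f\<close> at the matrix unit sending \<open>e i\<close> to \<open>e k\<close>. Comparing
  two permutations that differ by a transposition gives \<open>\<tau> k i + \<tau> l j = \<tau> l i + \<tau> k j\<close>, and since
  \<open>\<tau>\<close> vanishes at infinity along rows and columns, \<open>\<tau> = 0\<close>. Compressing to the first \<open>N\<close> basis
  vectors then shows that \<open>Re f\<close> vanishes at every operator with real matrix coefficients, hence
  both at \<open>a\<close> and on \<open>A\<close>, a contradiction.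
\<close>

section \<open>A minimax theorem for convex-like families\<close>

text \<open>The pairs \<open>(\<phi> b p, \<phi> c p)\<close> fill a compact convex subset of the
  plane, convex by \<open>mix\<close>. If it missed the quadrant
  \<open>{r..} \<times> {r..}\<close>, a line would strictly separate the two. The normal of that
  line has nonnegative entries, and rescaled to weights \<open>u\<close>, \<open>v\<close> of sum 1
  it yields a point \<open>u *\<^sub>R b + v *\<^sub>R c\<close> of \<open>A\<close> at which every
  \<open>p \<in> K\<close> stays below \<open>r\<close>, against \<open>ge\<close>.\<close>

lemma convexlike_minimax_two:
  fixes \<phi> :: "'b::real_vector \<Rightarrow> 'p \<Rightarrow> real"
  assumes comp: "compactin T K" and "convex A" and "b \<in> A" "c \<in> A"
    and cont: "\<And>b. b \<in> A \<Longrightarrow> continuous_map T euclideanreal (\<phi> b)"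
    and affine: "\<And>b c p u v. \<lbrakk>b \<in> A; c \<in> A; p \<in> K; u \<ge> 0; v \<ge> 0; u + v = 1\<rbrakk> \<Longrightarrow>
      \<phi> (u *\<^sub>R b + v *\<^sub>R c) p = u * \<phi> b p + v * \<phi> c p"
    and mix: "\<And>p q u v. \<lbrakk>p \<in> K; q \<in> K; u \<ge> 0; v \<ge> 0; u + v = 1\<rbrakk> \<Longrightarrow>
      \<exists>s\<in>K. \<forall>b\<in>A. \<phi> b s = u * \<phi> b p + v * \<phi> b q"
    and ge: "\<And>b. b \<in> A \<Longrightarrow> \<exists>p\<in>K. r \<le> \<phi> b p"
  shows "\<exists>p\<in>K. r \<le> \<phi> b p \<and> r \<le> \<phi> c p"
proof (rule ccontr)
  assume neg: "\<not> ?thesis"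
  define S where "S = (\<lambda>p. (\<phi> b p, \<phi> c p)) ` K"
  define Q where "Q = {r..} \<times> {r..}"
  have "convex S"
  proof (rule convexI)
    fix x y u v assume "x \<in> S" "y \<in> S" and uv: "(0::real) \<le> u" "0 \<le> v" "u + v = 1"
    then obtain p q where pq: "p \<in> K" "q \<in> K" "x = (\<phi> b p, \<phi> c p)" "y = (\<phi> b q, \<phi> c q)"
      unfolding S_def by blast
    then obtain s where "s \<in> K" "\<forall>b\<in>A. \<phi> b s = u * \<phi> b p + v * \<phi> b q"
      using mix uv by blast
    then show "u *\<^sub>R x + v *\<^sub>R y \<in> S"
      using pq \<open>b \<in> A\<close> \<open>c \<in> A\<close> unfolding S_def by (auto intro!: image_eqI[of _ _ s])
  qed
  moreover have "compact S"
  proof -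
    have "continuous_map T (prod_topology euclideanreal euclideanreal) (\<lambda>p. (\<phi> b p, \<phi> c p))"
      using cont \<open>b \<in> A\<close> \<open>c \<in> A\<close> by (blast intro: continuous_map_pairedI)
    then have "compactin (prod_topology euclideanreal euclideanreal) S"
      unfolding S_def by (rule image_compactin[OF comp])
    then show ?thesis by simp
  qed
  moreover have "S \<noteq> {}" using ge \<open>b \<in> A\<close> unfolding S_def by blast
  moreover have "convex Q" "closed Q" unfolding Q_def by (auto intro: convex_Times closed_Times)
  moreover have "S \<inter> Q = {}" using neg unfolding S_def Q_def by auto
  ultimately obtain z d where "\<forall>x\<in>S. inner z x < d" "\<forall>x\<in>Q. inner z x > d"
    by (metis separating_hyperplane_compact_closed)
  then obtain \<alpha> \<beta> where S: "\<And>p. p \<in> K \<Longrightarrow> \<alpha> * \<phi> b p + \<beta> * \<phi> c p < d"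
    and Q: "\<And>x y. x \<ge> r \<Longrightarrow> y \<ge> r \<Longrightarrow> \<alpha> * x + \<beta> * y > d"
    unfolding S_def Q_def by (cases z) fastforce
  \<comment> \<open>With a negative coefficient the separating functional would fall to
    \<open>d\<close> or below far out along an edge of the quadrant; \<open>x\<close> is such a
    point.\<close>
  have nonneg: "\<gamma> \<ge> 0" if "\<And>x. x \<ge> r \<Longrightarrow> \<gamma> * x + \<delta> > d" for \<gamma> \<delta>
  proof (rule ccontr)
    assume "\<not> \<gamma> \<ge> 0"
    define x where "x = max r ((d - \<delta>) / \<gamma>)"
    have "\<gamma> * x \<le> \<gamma> * ((d - \<delta>) / \<gamma>)"
      using \<open>\<not> \<gamma> \<ge> 0\<close> unfolding x_def by (intro mult_left_mono_neg) auto
    also have "\<dots> = d - \<delta>" using \<open>\<not> \<gamma> \<ge> 0\<close> by simp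
    finally show False using that[of x] unfolding x_def by simp
  qed
  have "\<alpha> \<ge> 0" using nonneg[of \<alpha> "\<beta> * r"] Q by auto
  have "\<beta> \<ge> 0" using nonneg[of \<beta> "\<alpha> * r"] Q by (auto simp: add.commute)
  \<comment> \<open>If both coefficients vanished, the quadrant would give \<open>0 > d\<close> and
    any point of \<open>K\<close> would give \<open>0 < d\<close>.\<close>
  have "\<alpha> + \<beta> > 0"
  proof (rule ccontr)
    assume "\<not> ?thesis"
    then have "\<alpha> = 0" "\<beta> = 0" using \<open>\<alpha> \<ge> 0\<close> \<open>\<beta> \<ge> 0\<close> by auto
    then show False using Q[of r r] S ge \<open>b \<in> A\<close> by fastforce
  qed
  define u v where "u = \<alpha> / (\<alpha> + \<beta>)" and "v = \<beta> / (\<alpha> + \<beta>)"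
  have uv: "u \<ge> 0" "v \<ge> 0" "u + v = 1"
    using \<open>\<alpha> \<ge> 0\<close> \<open>\<beta> \<ge> 0\<close> \<open>\<alpha> + \<beta> > 0\<close> unfolding u_def v_def
    by (auto simp: add_divide_distrib[symmetric])
  then have "u *\<^sub>R b + v *\<^sub>R c \<in> A"
    using \<open>convex A\<close> \<open>b \<in> A\<close> \<open>c \<in> A\<close> by (simp add: convex_def)
  then obtain p where p: "p \<in> K" "r \<le> \<phi> (u *\<^sub>R b + v *\<^sub>R c) p" using ge by blast
  then have "r \<le> u * \<phi> b p + v * \<phi> c p" using affine uv \<open>b \<in> A\<close> \<open>c \<in> A\<close> by simp
  also have "\<dots> = (\<alpha> * \<phi> b p + \<beta> * \<phi> c p) / (\<alpha> + \<beta>)"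
    unfolding u_def v_def by (simp add: add_divide_distrib)
  also have "\<dots> < d / (\<alpha> + \<beta>)" using S p \<open>\<alpha> + \<beta> > 0\<close> by (simp add: divide_strict_right_mono)
  also have "\<dots> < r" using Q[of r r] \<open>\<alpha> + \<beta> > 0\<close> by (simp add: field_simps)
  finally show False .
qed

lemma convexlike_minimax_finite:
  fixes \<phi> :: "'b::real_vector \<Rightarrow> 'p \<Rightarrow> real"
  assumes "finite B" and "B \<subseteq> A" and "A \<noteq> {}" and "compactin T K" and "convex A"
    and cont: "\<And>b. b \<in> A \<Longrightarrow> continuous_map T euclideanreal (\<phi> b)"
    and affine: "\<And>b c p u v. \<lbrakk>b \<in> A; c \<in> A; p \<in> K; u \<ge> 0; v \<ge> 0; u + v = 1\<rbrakk> \<Longrightarrow>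
      \<phi> (u *\<^sub>R b + v *\<^sub>R c) p = u * \<phi> b p + v * \<phi> c p"
    and mix: "\<And>p q u v. \<lbrakk>p \<in> K; q \<in> K; u \<ge> 0; v \<ge> 0; u + v = 1\<rbrakk> \<Longrightarrow>
      \<exists>s\<in>K. \<forall>b\<in>A. \<phi> b s = u * \<phi> b p + v * \<phi> b q"
    and ge: "\<And>b. b \<in> A \<Longrightarrow> \<exists>p\<in>K. r \<le> \<phi> b p"
  shows "\<exists>p\<in>K. \<forall>b\<in>B. r \<le> \<phi> b p"
  \<comment> \<open>The assumptions that mention \<open>K\<close> enter the induction and
    \<open>K\<close> is generalised, because the induction hypothesis is applied to a smaller
    compact set.\<close>
  using assms(1,2,4) affine mix ge
proof (induction B arbitrary: K rule: finite_induct)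
  case empty
  then show ?case using \<open>A \<noteq> {}\<close> by blast
next
  case (insert c B)
  \<comment> \<open>The two-point case says that the hypothesis survives the passage to the part of \<open>K\<close>
    where \<open>\<phi> c \<ge> r\<close>.\<close>
  define K' where "K' = K \<inter> {p \<in> topspace T. \<phi> c p \<in> {r..}}"
  have K': "K' = {p \<in> K. r \<le> \<phi> c p}"
    using compactin_subset_topspace[OF insert.prems(2)] unfolding K'_def by auto
  have "c \<in> A" using insert.prems by simp
  have "\<exists>p\<in>K'. \<forall>b\<in>B. r \<le> \<phi> b p"
  proof (rule insert.IH)
    show "B \<subseteq> A" using insert.prems by simp
    show "compactin T K'"
      unfolding K'_def using insert.prems(2) cont[OF \<open>c \<in> A\<close>]
      by (intro compact_Int_closedin closedin_continuous_map_preimage) auto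
    show "\<phi> (u *\<^sub>R b + v *\<^sub>R d) p = u * \<phi> b p + v * \<phi> d p"
      if "b \<in> A" "d \<in> A" "p \<in> K'" "u \<ge> 0" "v \<ge> 0" "u + v = 1" for b d p u v
      using that insert.prems(3) K' by blast
    show "\<exists>s\<in>K'. \<forall>b\<in>A. \<phi> b s = u * \<phi> b p + v * \<phi> b q"
      if "p \<in> K'" "q \<in> K'" and uv: "u \<ge> 0" "v \<ge> 0" "u + v = 1" for p q u v
    proof -
      have pq: "p \<in> K" "q \<in> K" "r \<le> \<phi> c p" "r \<le> \<phi> c q" using that K' by auto
      then obtain s where s: "s \<in> K" "\<forall>b\<in>A. \<phi> b s = u * \<phi> b p + v * \<phi> b q"
        using insert.prems(4) uv by blast
      have "r = u * r + v * r" using uv by (simp add: distrib_right[symmetric])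
      also have "\<dots> \<le> \<phi> c s" using s pq uv \<open>c \<in> A\<close> by (simp add: add_mono mult_left_mono)
      finally show ?thesis using s K' by blast
    qed
    show "\<exists>p\<in>K'. r \<le> \<phi> b p" if "b \<in> A" for b
      using convexlike_minimax_two[OF insert.prems(2) \<open>convex A\<close> that \<open>c \<in> A\<close> cont insert.prems(3-5)]
      unfolding K' by blast
  qed
  then show ?case unfolding K' by auto
qed

text \<open>The conditions \<open>r \<le> \<phi> b p\<close> cut out closed sets, and by the finite
  case any finitely many of them meet inside \<open>K\<close>. Compactness gives a point common to
  all.\<close>

lemma convexlike_minimax:
  fixes \<phi> :: "'b::real_vector \<Rightarrow> 'p \<Rightarrow> real"
  assumes comp: "compactin T K" and "convex A" and "A \<noteq> {}"
    and cont: "\<And>b. b \<in> A \<Longrightarrow> continuous_map T euclideanreal (\<phi> b)"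
    and affine: "\<And>b c p u v. \<lbrakk>b \<in> A; c \<in> A; p \<in> K; u \<ge> 0; v \<ge> 0; u + v = 1\<rbrakk> \<Longrightarrow>
      \<phi> (u *\<^sub>R b + v *\<^sub>R c) p = u * \<phi> b p + v * \<phi> c p"
    and mix: "\<And>p q u v. \<lbrakk>p \<in> K; q \<in> K; u \<ge> 0; v \<ge> 0; u + v = 1\<rbrakk> \<Longrightarrow>
      \<exists>s\<in>K. \<forall>b\<in>A. \<phi> b s = u * \<phi> b p + v * \<phi> b q"
    and ge: "\<And>b. b \<in> A \<Longrightarrow> \<exists>p\<in>K. r \<le> \<phi> b p"
  shows "\<exists>p\<in>K. \<forall>b\<in>A. r \<le> \<phi> b p"
proof -
  define C where "C b = {p \<in> topspace T. \<phi> b p \<in> {r..}}" for b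
  have "K \<inter> \<Inter>(C ` A) \<noteq> {}"
  proof (rule compactin_fip[THEN iffD1, OF comp, THEN conjunct2, rule_format], intro conjI allI impI ballI)
    show "closedin T X" if X: "X \<in> C ` A" for X
    proof -
      obtain b where "b \<in> A" "X = C b" using X by auto
      then show ?thesis
        unfolding C_def by (metis closedin_continuous_map_preimage[OF cont] closed_closedin closed_atLeast)
    qed
    show "K \<inter> \<Inter>\<F> \<noteq> {}" if \<F>: "finite \<F> \<and> \<F> \<subseteq> C ` A" for \<F>
    proof -
      obtain B where B: "finite B" "B \<subseteq> A" "\<F> = C ` B"
        using \<F> finite_subset_image by meson
      obtain p where "p \<in> K" "\<forall>b\<in>B. r \<le> \<phi> b p"
        using convexlike_minimax_finite[OF B(1,2) \<open>A \<noteq> {}\<close> comp \<open>convex A\<close> cont affine mix ge]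
        by blast
      then show ?thesis
        using compactin_subset_topspace[OF comp] B unfolding C_def by auto
    qed
  qed
  then show ?thesis unfolding C_def by auto
qed

section \<open>Separation in the Mackey topology\<close>

text \<open>Multiplication by \<open>cnj (sgn z)\<close> turns \<open>z\<close> onto the nonnegative
  real axis, which lets a modulus be replaced by a real part.\<close>

lemma cnj_sgn_mult: "cnj (sgn z) * z = complex_of_real (cmod z)"
  unfolding sgn_eq
  by (cases "z = 0") (simp_all add: mult.commute[of "cnj _"] power2_eq_square flip: complex_norm_square)

text \<open>One half of a dual pair, in the form that the Mackey topology uses. The carrier lies in
  a real vector space, so functionals are additive and real homogeneous, while complex scalars act
  on their values through \<open>combination\<close>.\<close>

locale functional_space =
  fixes X :: "'a::real_vector set" and Y :: "('a \<Rightarrow> complex) set"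
  assumes subspace: "subspace X"
    and nonempty: "Y \<noteq> {}"
    and extensional: "f \<in> Y \<Longrightarrow> f \<in> extensional X"
    and add: "\<lbrakk>f \<in> Y; a \<in> X; b \<in> X\<rbrakk> \<Longrightarrow> f (a + b) = f a + f b"
    and scale: "\<lbrakk>f \<in> Y; a \<in> X\<rbrakk> \<Longrightarrow> f (r *\<^sub>R a) = r *\<^sub>R f a"
    and combination: "\<lbrakk>f \<in> Y; g \<in> Y\<rbrakk> \<Longrightarrow> (\<lambda>a\<in>X. s * f a + t * g a) \<in> Y"
begin

abbreviation weak where "weak \<equiv> weak_topology_on_functionals X Y"
abbreviation mackey where "mackey \<equiv> mackey_topology X Y"

definition polar_index :: "('a \<Rightarrow> complex) set \<Rightarrow> bool" where
  "polar_index K \<longleftrightarrow> absolutely_convex X K \<and> compactin weak K"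

text \<open>The translate to \<open>a\<close> of \<open>r\<close> times the polar of
  \<open>K\<close>, taken with a strict inequality.\<close>

definition polar_nbhd :: "'a \<Rightarrow> ('a \<Rightarrow> complex) set \<Rightarrow> real \<Rightarrow> 'a set" where
  "polar_nbhd a K r = {b \<in> X. \<forall>f\<in>K. cmod (f (b - a)) < r}"

lemma mackey_eq: "mackey = topology_generated_by {polar_nbhd a K r | a K r. a \<in> X \<and> r > 0 \<and> polar_index K}"
  unfolding mackey_topology_def polar_nbhd_def polar_index_def by simp

lemma diff: "\<lbrakk>f \<in> Y; a \<in> X; b \<in> X\<rbrakk> \<Longrightarrow> f (a - b) = f a - f b"
  using add[of f a "(-1) *\<^sub>R b"] scale[of f b "-1"] subspace by (simp add: subspace_neg)

lemma zero: "f \<in> Y \<Longrightarrow> f 0 = 0"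
  using diff[of f 0 0] subspace_0[OF subspace] by simp

lemma topspace_weak: "topspace weak = Y"
  unfolding weak_topology_on_functionals_def using extensional by (auto simp: PiE_def)

lemma continuous_evaluation: "a \<in> X \<Longrightarrow> continuous_map weak euclidean (\<lambda>f. f a)"
  unfolding weak_topology_on_functionals_def
  by (intro continuous_map_from_subtopology)
    (metis (no_types) continuous_map_product_projection)

lemma continuous_map_into_weak:
  assumes "\<And>p. p \<in> topspace T \<Longrightarrow> F p \<in> Y"
    and "\<And>a. a \<in> X \<Longrightarrow> continuous_map T euclidean (\<lambda>p. F p a)"
  shows "continuous_map T weak F"
  unfolding weak_topology_on_functionals_def continuous_map_in_subtopology continuous_map_componentwise
  using assms extensional by auto

lemma polar_index_subset: "polar_index K \<Longrightarrow> K \<subseteq> Y"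
  unfolding polar_index_def using compactin_subset_topspace topspace_weak by blast

section \<open>Operations on absolutely convex weakly compact sets\<close>

lemma polar_index_combination:
  "\<lbrakk>polar_index K; f \<in> K; g \<in> K; cmod s + cmod t \<le> 1\<rbrakk> \<Longrightarrow> (\<lambda>a\<in>X. s * f a + t * g a) \<in> K"
  unfolding polar_index_def absolutely_convex_def by blast

lemma combination_1: "f \<in> Y \<Longrightarrow> (\<lambda>a\<in>X. s * f a) \<in> Y"
  using combination[of f f s 0] by simp

text \<open>Rescaling \<open>K\<close> absorbs the radius of a neighbourhood, so that radius 1
  suffices later.\<close>

lemma polar_index_scale:
  assumes "polar_index K"
  shows "polar_index ((\<lambda>f. \<lambda>a\<in>X. c * f a) ` K)"
  unfolding polar_index_def
proof
  show "absolutely_convex X ((\<lambda>f. \<lambda>a\<in>X. c * f a) ` K)"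
    unfolding absolutely_convex_def
  proof clarify
    fix f g s t assume fg: "f \<in> K" "g \<in> K" and st: "cmod s + cmod t \<le> 1"
    show "(\<lambda>a\<in>X. s * (\<lambda>a\<in>X. c * f a) a + t * (\<lambda>a\<in>X. c * g a) a) \<in> (\<lambda>f. \<lambda>a\<in>X. c * f a) ` K"
      by (rule image_eqI[OF _ polar_index_combination[OF assms fg st]])
        (auto simp: algebra_simps restrict_def)
  qed
  show "compactin weak ((\<lambda>f. \<lambda>a\<in>X. c * f a) ` K)"
  proof (rule image_compactin)
    show "compactin weak K" using assms polar_index_def by simp
    show "continuous_map weak weak (\<lambda>f. \<lambda>a\<in>X. c * f a)"
      by (rule continuous_map_into_weak)
        (auto simp: topspace_weak combination_1 intro!: continuous_map_compose[OF continuous_evaluation, where g = "\<lambda>z. c * z", unfolded o_def] continuous_intros)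
  qed
qed

text \<open>The sum of nonempty \<open>K\<close> and \<open>L\<close> contains both, since each
  contains 0; its polar therefore lies in the intersection of their polars. It is compact as a
  continuous image of \<open>K \<times> L\<close>.\<close>

lemma polar_index_add:
  assumes "polar_index K" "polar_index L"
  shows "polar_index ((\<lambda>(f, g). \<lambda>a\<in>X. f a + g a) ` (K \<times> L))"
  unfolding polar_index_def
proof
  show "absolutely_convex X ((\<lambda>(f, g). \<lambda>a\<in>X. f a + g a) ` (K \<times> L))"
    unfolding absolutely_convex_def
  proof clarify
    fix f g f' g' s t assume fg: "f \<in> K" "g \<in> L" "f' \<in> K" "g' \<in> L" and st: "cmod s + cmod t \<le> 1"
    show "(\<lambda>a\<in>X. s * (\<lambda>a\<in>X. f a + g a) a + t * (\<lambda>a\<in>X. f' a + g' a) a)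
      \<in> (\<lambda>(f, g). \<lambda>a\<in>X. f a + g a) ` (K \<times> L)"
      by (rule image_eqI[where x = "(\<lambda>a\<in>X. s * f a + t * f' a, \<lambda>a\<in>X. s * g a + t * g' a)"])
        (use fg st assms in \<open>auto simp: algebra_simps restrict_def intro!: polar_index_combination[unfolded restrict_def]\<close>)
  qed
  show "compactin weak ((\<lambda>(f, g). \<lambda>a\<in>X. f a + g a) ` (K \<times> L))"
  proof (rule image_compactin)
    show "compactin (prod_topology weak weak) (K \<times> L)"
      using assms by (simp add: compactin_Times polar_index_def)
    show "continuous_map (prod_topology weak weak) weak (\<lambda>(f, g). \<lambda>a\<in>X. f a + g a)"
    proof (rule continuous_map_into_weak)
      show "(case p of (f, g) \<Rightarrow> \<lambda>a\<in>X. f a + g a) \<in> Y" if "p \<in> topspace (prod_topology weak weak)" for p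
        using that combination[of "fst p" "snd p" 1 1] by (auto simp: topspace_weak)
      show "continuous_map (prod_topology weak weak) euclidean
          (\<lambda>p. (case p of (f, g) \<Rightarrow> \<lambda>a\<in>X. f a + g a) a)" if "a \<in> X" for a
        unfolding case_prod_unfold using that
        by (auto intro!: continuous_map_add
            continuous_map_compose[OF continuous_map_fst continuous_evaluation[OF that], unfolded o_def]
            continuous_map_compose[OF continuous_map_snd continuous_evaluation[OF that], unfolded o_def])
    qed
  qed
qed

text \<open>The disc spanned by a single functional. It contains \<open>f\<close>, so its polar
  neighbourhoods witness the Mackey continuity of \<open>f\<close>.\<close>

lemma polar_index_disc:
  assumes "f \<in> Y"
  shows "polar_index ((\<lambda>s. \<lambda>a\<in>X. s * f a) ` cball 0 1)"
  unfolding polar_index_def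
proof
  show "absolutely_convex X ((\<lambda>s. \<lambda>a\<in>X. s * f a) ` cball 0 1)"
    unfolding absolutely_convex_def
  proof clarify
    fix s t u v :: complex assume st: "s \<in> cball 0 1" "t \<in> cball 0 1" and uv: "cmod u + cmod v \<le> 1"
    have "cmod (u * s + v * t) \<le> cmod u * cmod s + cmod v * cmod t"
      by (metis norm_mult norm_triangle_ineq)
    also have "\<dots> \<le> cmod u * 1 + cmod v * 1"
      using st by (intro add_mono mult_left_mono) auto
    finally have "u * s + v * t \<in> cball 0 1" using uv by simp
    then show "(\<lambda>a\<in>X. u * (\<lambda>a\<in>X. s * f a) a + v * (\<lambda>a\<in>X. t * f a) a) \<in> (\<lambda>s. \<lambda>a\<in>X. s * f a) ` cball 0 1"
      by (rule image_eqI[rotated]) (auto simp: algebra_simps restrict_def)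
  qed
  show "compactin weak ((\<lambda>s. \<lambda>a\<in>X. s * f a) ` cball 0 1)"
  proof (rule image_compactin)
    show "compactin euclidean (cball (0::complex) 1)" by simp
    show "continuous_map euclidean weak (\<lambda>s. \<lambda>a\<in>X. s * f a)"
      by (rule continuous_map_into_weak) (use assms in \<open>auto simp: combination_1 intro!: continuous_intros\<close>)
  qed
qed

section \<open>Neighbourhoods and continuity in the Mackey topology\<close>

lemma openin_polar_nbhd: "\<lbrakk>a \<in> X; r > 0; polar_index K\<rbrakk> \<Longrightarrow> openin mackey (polar_nbhd a K r)"
  unfolding mackey_eq by (rule topology_generated_by_Basis) blast

lemma mem_polar_nbhd: "\<lbrakk>a \<in> X; r > 0; polar_index K\<rbrakk> \<Longrightarrow> a \<in> polar_nbhd a K r"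
  unfolding polar_nbhd_def by (simp add: zero[OF subsetD[OF polar_index_subset]])

lemma topspace_mackey: "topspace mackey = X"
proof
  show "topspace mackey \<subseteq> X"
    unfolding mackey_eq topology_generated_by_topspace by (auto simp: polar_nbhd_def)
  obtain f where "f \<in> Y" using nonempty by blast
  then show "X \<subseteq> topspace mackey"
    using mem_polar_nbhd[OF _ zero_less_one polar_index_disc] openin_polar_nbhd[OF _ zero_less_one polar_index_disc]
    by (meson openin_subset subsetD subsetI)
qed

lemma continuous_map_mackey:
  assumes "f \<in> Y"
  shows "continuous_map mackey euclidean f"
  unfolding continuous_map_def
proof (intro conjI allI impI)
  fix U :: "complex set" assume "openin euclidean U"
  then have "open U" by simp
  show "openin mackey {a \<in> topspace mackey. f a \<in> U}"
  proof (subst openin_subopen, intro ballI)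
    fix a assume "a \<in> {a \<in> topspace mackey. f a \<in> U}"
    then have a: "a \<in> X" "f a \<in> U" by (auto simp: topspace_mackey)
    then obtain r where r: "r > 0" "ball (f a) r \<subseteq> U"
      using \<open>open U\<close> openE by blast
    define K where "K = (\<lambda>s. \<lambda>a\<in>X. s * f a) ` cball 0 1"
    have K: "polar_index K" unfolding K_def by (rule polar_index_disc[OF assms])
    have "f \<in> K" unfolding K_def
      using extensional[OF assms] by (intro image_eqI[of _ _ 1]) (auto simp: extensional_restrict)
    have "polar_nbhd a K r \<subseteq> {a \<in> topspace mackey. f a \<in> U}"
    proof
      fix b assume "b \<in> polar_nbhd a K r"
      then have "b \<in> X" "cmod (f (b - a)) < r" using \<open>f \<in> K\<close> unfolding polar_nbhd_def by auto
      then have "f b \<in> ball (f a) r"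
        using diff[OF assms, of b a] a by (simp add: dist_norm norm_minus_commute)
      then show "b \<in> {a \<in> topspace mackey. f a \<in> U}" using r \<open>b \<in> X\<close> by (auto simp: topspace_mackey)
    qed
    then show "\<exists>T. openin mackey T \<and> a \<in> T \<and> T \<subseteq> {a \<in> topspace mackey. f a \<in> U}"
      using openin_polar_nbhd[OF a(1) r(1) K] mem_polar_nbhd[OF a(1) r(1) K] by meson
  qed
qed (auto simp: topspace_mackey)

text \<open>The generating sets have arbitrary centres and radii, and finite intersections of them
  are allowed. Induction over the generation of \<open>U\<close> recentres at \<open>a\<close> with
  radius 1: intersections are handled by sums of index sets, generating sets by rescaling.\<close>

lemma mackey_nbhd_base:
  assumes "openin mackey U" and "a \<in> U"
  obtains K where "polar_index K" "polar_nbhd a K 1 \<subseteq> U"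
proof -
  have aX: "a \<in> X" using assms openin_subset topspace_mackey by blast
  have "generate_topology_on {polar_nbhd a K r | a K r. a \<in> X \<and> r > 0 \<and> polar_index K} U"
    using assms(1) unfolding mackey_eq by (rule openin_topology_generated_by)
  then have "\<exists>K. polar_index K \<and> polar_nbhd a K 1 \<subseteq> U"
    using \<open>a \<in> U\<close>
  proof (induction rule: generate_topology_on.induct)
    case (Int U V)
    then obtain K L where K: "polar_index K" "polar_nbhd a K 1 \<subseteq> U"
      and L: "polar_index L" "polar_nbhd a L 1 \<subseteq> V" by auto
    show ?case
    \<comment> \<open>An empty index set is admissible and has all of \<open>X\<close> as its
      neighbourhood, but it would make the sum \<open>K + L\<close> empty too; hence the separate
      case.\<close>
    proof (cases "K = {} \<or> L = {}")
      case True
      then show ?thesis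
      proof
        assume "K = {}"
        then have "polar_nbhd a L 1 \<subseteq> polar_nbhd a K 1" unfolding polar_nbhd_def by auto
        then show ?thesis using K L by blast
      next
        assume "L = {}"
        then have "polar_nbhd a K 1 \<subseteq> polar_nbhd a L 1" unfolding polar_nbhd_def by auto
        then show ?thesis using K L by blast
      qed
    next
      case False
      define M where "M = (\<lambda>(f, g). \<lambda>a\<in>X. f a + g a) ` (K \<times> L)"
      have zero_mem: "(\<lambda>a\<in>X. 0) \<in> N" if "polar_index N" "N \<noteq> {}" for N
        using that polar_index_combination[of N _ _ 0 0] by fastforce
      have "f \<in> M" if "f \<in> K" for f
        unfolding M_def using that zero_mem[OF L(1)] False polar_index_subset[OF K(1)] extensional[of f]
        by (intro image_eqI[of _ _ "(f, \<lambda>a\<in>X. 0)"]) (auto simp: extensional_def fun_eq_iff)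
      moreover have "f \<in> M" if "f \<in> L" for f
        unfolding M_def using that zero_mem[OF K(1)] False polar_index_subset[OF L(1)] extensional[of f]
        by (intro image_eqI[of _ _ "(\<lambda>a\<in>X. 0, f)"]) (auto simp: extensional_def fun_eq_iff)
      ultimately have "polar_nbhd a M 1 \<subseteq> polar_nbhd a K 1 \<inter> polar_nbhd a L 1"
        unfolding polar_nbhd_def by auto
      moreover have "polar_index M" unfolding M_def using K L by (intro polar_index_add)
      ultimately show ?thesis using K L by blast
    qed
  next
    case (UN \<U>)
    then show ?case by blast
  next
    case (Basis U)
    then obtain c K r where cK: "U = polar_nbhd c K r" "c \<in> X" "r > 0" "polar_index K" by blast
    have K: "K \<subseteq> Y" using polar_index_subset cK by blast
    \<comment> \<open>Weak compactness makes the supremum over \<open>K\<close> an attained maximum,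
      so it stays strictly below \<open>r\<close>. The gap \<open>r - s\<close> is the room left for
      moving the centre from \<open>c\<close> to \<open>a\<close>.\<close>
    have "\<exists>s<r. \<forall>f\<in>K. cmod (f (a - c)) \<le> s"
    proof (cases "K = {}")
      case True
      then show ?thesis by (auto intro: exI[of _ "r - 1"])
    next
      case False
      have "a - c \<in> X" using aX cK subspace by (simp add: subspace_diff)
      have "compactin euclidean ((\<lambda>f. f (a - c)) ` K)"
        using cK image_compactin[OF _ continuous_evaluation[OF \<open>a - c \<in> X\<close>]] by (simp add: polar_index_def)
      then have "compact (cmod ` (\<lambda>f. f (a - c)) ` K)"
        by (simp add: compact_continuous_image continuous_on_norm_id)
      then obtain f where "f \<in> K" "\<forall>g\<in>K. cmod (g (a - c)) \<le> cmod (f (a - c))"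
        using compact_attains_sup[of "cmod ` (\<lambda>f. f (a - c)) ` K"] False by auto
      then show ?thesis using Basis cK unfolding polar_nbhd_def by auto
    qed
    then obtain s where s: "s < r" "\<And>f. f \<in> K \<Longrightarrow> cmod (f (a - c)) \<le> s" by blast
    define L where "L = (\<lambda>f. \<lambda>a\<in>X. complex_of_real (1 / (r - s)) * f a) ` K"
    have "polar_nbhd a L 1 \<subseteq> U"
    proof
      fix b assume "b \<in> polar_nbhd a L 1"
      then have b: "b \<in> X" "\<And>g. g \<in> L \<Longrightarrow> cmod (g (b - a)) < 1" unfolding polar_nbhd_def by auto
      have "b - a \<in> X" using aX b subspace by (simp add: subspace_diff)
      have "cmod (f (b - c)) < r" if "f \<in> K" for f
      proof -
        have "cmod (complex_of_real (1 / (r - s)) * f (b - a)) < 1"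
          using b(2)[of "\<lambda>a\<in>X. complex_of_real (1 / (r - s)) * f a"] that \<open>b - a \<in> X\<close> unfolding L_def by auto
        then have "cmod (f (b - a)) < r - s"
          using s(1) unfolding norm_mult norm_of_real by (simp add: field_simps)
        moreover have "f (b - c) = f (b - a) + f (a - c)"
          using that K aX b(1) cK(2) diff[of f b c] diff[of f b a] diff[of f a c] by auto
        ultimately show ?thesis
          using s(2)[OF that] norm_triangle_ineq[of "f (b - a)" "f (a - c)"] by simp
      qed
      then show "b \<in> U" using b cK unfolding polar_nbhd_def by auto
    qed
    moreover have "polar_index L" unfolding L_def using cK by (intro polar_index_scale)
    ultimately show ?case by blast
  qed auto
  then show thesis using that by blast
qed

section \<open>Separation of a point from an affine set\<close>

lemma Re_constant_on_affine:
  assumes "f \<in> Y" and "affine A" and "A \<subseteq> X" and lb: "\<And>b. b \<in> A \<Longrightarrow> r \<le> Re (f b)"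
    and bc: "b \<in> A" "c \<in> A"
  shows "Re (f b) = Re (f c)"
proof (rule ccontr)
  assume neq: "Re (f b) \<noteq> Re (f c)"
  \<comment> \<open>An affine function bounded below on a whole line is constant: with distinct
    values at \<open>b\<close> and \<open>c\<close>, this \<open>t\<close> is the parameter at which
    the line through them takes the forbidden value \<open>r - 1\<close>.\<close>
  define t where "t = (r - 1 - Re (f c)) / (Re (f b) - Re (f c))"
  have "t *\<^sub>R b + (1 - t) *\<^sub>R c \<in> A" using \<open>affine A\<close> bc by (simp add: affine_def)
  moreover have "f (t *\<^sub>R b + (1 - t) *\<^sub>R c) = t *\<^sub>R f b + (1 - t) *\<^sub>R f c"
    using add[OF \<open>f \<in> Y\<close>, of "t *\<^sub>R b" "(1 - t) *\<^sub>R c"] scale[OF \<open>f \<in> Y\<close>, of b t]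
      scale[OF \<open>f \<in> Y\<close>, of c "1 - t"] subspace bc \<open>A \<subseteq> X\<close>
    by (simp add: subspace_scale subset_iff)
  ultimately have "r \<le> t * Re (f b) + (1 - t) * Re (f c)" using lb by force
  also have "\<dots> = t * (Re (f b) - Re (f c)) + Re (f c)" by (simp add: algebra_simps)
  also have "\<dots> = r - 1" using neq unfolding t_def by simp
  finally show False by simp
qed

text \<open>
  The minimax theorem, applied to \<open>\<phi> b f = Re (f (b - a))\<close> on a weakly compact \<open>K\<close>, replaces
  the Hahn-Banach theorem and the Mackey-Arens theorem.
\<close>

theorem mackey_separation:
  assumes "affine A" and "A \<subseteq> X" and "A \<noteq> {}" and "a \<in> X" and notin: "a \<notin> mackey closure_of A"
  obtains f where "f \<in> Y" "\<And>b. b \<in> A \<Longrightarrow> Re (f b) \<noteq> Re (f a)" "\<And>b c. b \<in> A \<Longrightarrow> c \<in> A \<Longrightarrow> Re (f b) = Re (f c)"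
proof -
  obtain U where "openin mackey U" "a \<in> U" and U: "A \<inter> U = {}"
    using notin \<open>a \<in> X\<close> by (auto simp: in_closure_of topspace_mackey)
  then obtain K where K: "polar_index K" "polar_nbhd a K 1 \<subseteq> U"
    using mackey_nbhd_base by blast
  have KY: "K \<subseteq> Y" using polar_index_subset K by blast
  have ba: "b - a \<in> X" if "b \<in> A" for b
    using that assms subspace by (auto intro: subspace_diff)
  have "\<exists>f\<in>K. \<forall>b\<in>A. 1 \<le> Re (f (b - a))"
  proof (rule convexlike_minimax[where T = weak and \<phi> = "\<lambda>b f. Re (f (b - a))"])
    show "compactin weak K" using K polar_index_def by blast
    show "convex A" using \<open>affine A\<close> by (rule affine_imp_convex)
    show "A \<noteq> {}" by fact
    show "continuous_map weak euclideanreal (\<lambda>f. Re (f (b - a)))" if "b \<in> A" for b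
      using continuous_map_compose[OF continuous_evaluation[OF ba[OF that]], of euclideanreal Re]
      by (simp add: o_def continuous_on_Re)
    show "Re (f (u *\<^sub>R b + v *\<^sub>R c - a)) = u * Re (f (b - a)) + v * Re (f (c - a))"
      if "b \<in> A" "c \<in> A" "f \<in> K" "u + v = 1" for b c f u v
    proof -
      have "u *\<^sub>R b + v *\<^sub>R c - a = u *\<^sub>R (b - a) + v *\<^sub>R (c - a)"
        using scaleR_add_left[of u v a] \<open>u + v = 1\<close> by (simp add: scaleR_diff_right algebra_simps)
      then have "f (u *\<^sub>R b + v *\<^sub>R c - a) = u *\<^sub>R f (b - a) + v *\<^sub>R f (c - a)"
        using add[of f "u *\<^sub>R (b - a)" "v *\<^sub>R (c - a)"] scale[of f "b - a" u] scale[of f "c - a" v]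
          that ba KY subspace by (simp add: subspace_scale subset_iff)
      then show ?thesis by simp
    qed
    show "\<exists>h\<in>K. \<forall>b\<in>A. Re (h (b - a)) = u * Re (f (b - a)) + v * Re (g (b - a))"
      if "f \<in> K" "g \<in> K" "0 \<le> u" "0 \<le> v" "u + v = 1" for f g u v
      by (rule bexI[OF _ polar_index_combination[OF K(1) that(1,2), of u v]]) (use that ba in auto)
    show "\<exists>f\<in>K. 1 \<le> Re (f (b - a))" if b: "b \<in> A" for b
    proof -
      have "b \<notin> polar_nbhd a K 1" using b K U by blast
      then obtain f where f: "f \<in> K" "1 \<le> cmod (f (b - a))"
        using b \<open>A \<subseteq> X\<close> unfolding polar_nbhd_def by force
      \<comment> \<open>Since \<open>K\<close> is closed under multiplication by scalars of modulus
        at most 1, \<open>f\<close> can be rotated until its value at \<open>b - a\<close> is real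
        and nonnegative; the bound on the modulus becomes one on the real part.\<close>
      define s where "s = cnj (sgn (f (b - a)))"
      have "cmod s \<le> 1" unfolding s_def by (simp add: norm_sgn)
      then have mem: "(\<lambda>a\<in>X. s * f a + 0 * f a) \<in> K"
        by (intro polar_index_combination[OF K(1) f(1,1)]) simp
      have "s * f (b - a) = complex_of_real (cmod (f (b - a)))"
        unfolding s_def by (rule cnj_sgn_mult)
      then show ?thesis using mem f(2) ba[OF b] by (intro bexI[OF _ mem]) simp
    qed
  qed
  then obtain f where f: "f \<in> K" "\<And>b. b \<in> A \<Longrightarrow> 1 \<le> Re (f (b - a))" by blast
  then have "f \<in> Y" using KY by blast
  have ge: "Re (f a) + 1 \<le> Re (f b)" if "b \<in> A" for b
    using f(2)[OF that] diff[OF \<open>f \<in> Y\<close>, of b a] that \<open>A \<subseteq> X\<close> \<open>a \<in> X\<close> by auto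
  show thesis
  proof
    show "Re (f b) \<noteq> Re (f a)" if "b \<in> A" for b using ge[OF that] by simp
    show "Re (f b) = Re (f c)" if "b \<in> A" "c \<in> A" for b c
      using Re_constant_on_affine[OF \<open>f \<in> Y\<close> \<open>affine A\<close> \<open>A \<subseteq> X\<close> ge that] .
  qed fact
qed

end

section \<open>The predual of \<open>B(H)\<close>\<close>

lemma norm_scaleC: "norm (c *\<^sub>C x) = cmod c * norm x" for x :: "'h::complex_hilbert_space"
proof -
  have "cinner x (c *\<^sub>C x) = cnj c * cinner x x"
    by (metis cinner_commute cinner_scaleC_left complex_cnj_mult)
  then have "cinner (c *\<^sub>C x) (c *\<^sub>C x) = complex_of_real ((cmod c)\<^sup>2) * cinner x x"
    unfolding complex_norm_square by (simp add: cinner_scaleC_left mult.assoc)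
  then have "(norm (c *\<^sub>C x))\<^sup>2 = (cmod c * norm x)\<^sup>2"
    by (simp add: power2_norm_eq_inner inner_eq_Re_cinner power_mult_distrib)
  then show ?thesis by (simp add: power2_eq_iff_nonneg)
qed

text \<open>Rotating \<open>x\<close> by a unimodular scalar makes the inner product real without
  changing norms, and the real Cauchy-Schwarz inequality applies.\<close>

lemma cmod_cinner_le: "cmod (cinner x y) \<le> norm x * norm y" for x y :: "'h::complex_hilbert_space"
proof (cases "cinner x y = 0")
  case False
  define c where "c = cnj (sgn (cinner x y))"
  have "c * cinner x y = complex_of_real (cmod (cinner x y))"
    unfolding c_def by (rule cnj_sgn_mult)
  then have "cmod (cinner x y) = inner (c *\<^sub>C x) y"
    by (simp add: inner_eq_Re_cinner cinner_scaleC_left)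
  also have "\<dots> \<le> norm (c *\<^sub>C x) * norm y" by (rule norm_cauchy_schwarz)
  also have "\<dots> = norm x * norm y" using False by (simp add: norm_scaleC c_def norm_sgn)
  finally show ?thesis .
qed simp

lemma bounded_bilinear_cinner:
  "bounded_bilinear (cinner :: 'h::complex_hilbert_space \<Rightarrow> 'h \<Rightarrow> complex)"
proof
  show add: "cinner (a + a') b = cinner a b + cinner a' b" for a a' b :: 'h
    by (rule cinner_add_left)
  show "cinner a (b + b') = cinner a b + cinner a b'" for a b b' :: 'h
    by (metis cinner_add_left cinner_commute complex_cnj_add)
  show scale: "cinner (r *\<^sub>R a) b = r *\<^sub>R cinner a b" for r and a b :: 'h
    by (simp add: scaleR_scaleC cinner_scaleC_left scaleR_conv_of_real)
  show "cinner a (r *\<^sub>R b) = r *\<^sub>R cinner a b" for r and a b :: 'h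
    by (metis scale cinner_commute complex_cnj_scaleR)
  show "\<exists>K. \<forall>a b :: 'h. cmod (cinner a b) \<le> norm a * norm b * K"
    by (intro exI[of _ 1]) (simp add: cmod_cinner_le)
qed

interpretation cinner: bounded_bilinear cinner
  by (rule bounded_bilinear_cinner)

lemma cinner_scaleC_right: "cinner x (c *\<^sub>C y) = cnj c * cinner x y"
  by (metis cinner_commute cinner_scaleC_left complex_cnj_mult)

lemma subspace_BH: "subspace (BH :: ('h::complex_hilbert_space \<Rightarrow>\<^sub>L 'h) set)"
  unfolding subspace_def BH_def
  by (auto simp: plus_blinfun.rep_eq zero_blinfun.rep_eq scaleR_blinfun.rep_eq scaleC_add_right
      scaleR_scaleC scaleC_scaleC mult.commute)

lemma BH_compose: "a \<in> BH \<Longrightarrow> b \<in> BH \<Longrightarrow> a o\<^sub>L b \<in> BH"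
  by (simp add: BH_def)

section \<open>Normal functionals and their linear structure\<close>

definition square_summable :: "(nat \<Rightarrow> 'h::complex_hilbert_space) \<Rightarrow> bool" where
  "square_summable x \<longleftrightarrow> summable (\<lambda>n. (norm (x n))\<^sup>2)"

definition normal_functional :: "(nat \<Rightarrow> 'h::complex_hilbert_space) \<Rightarrow> (nat \<Rightarrow> 'h) \<Rightarrow> ('h \<Rightarrow>\<^sub>L 'h) \<Rightarrow> complex"
  where "normal_functional x y = (\<lambda>a\<in>BH. \<Sum>n. cinner (blinfun_apply a (x n)) (y n))"

lemma predual_BH_eq:
  "predual_BH = {normal_functional x y | x y. square_summable x \<and> square_summable y}"
  unfolding predual_BH_def normal_functional_def square_summable_def ..

text \<open>Cauchy-Schwarz followed by \<open>s * t \<le> s^2 + t^2\<close>. The bound depends on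
  \<open>a\<close> only through \<open>C\<close>, so it dominates the series uniformly over norm
  bounded sets of operators.\<close>

lemma normal_functional_term_bound:
  assumes "norm a \<le> C"
  shows "cmod (cinner (blinfun_apply a (x n)) (y n)) \<le> C * ((norm (x n))\<^sup>2 + (norm (y n))\<^sup>2)"
proof -
  have "C \<ge> 0" using assms norm_ge_zero order_trans by blast
  have "cmod (cinner (blinfun_apply a (x n)) (y n)) \<le> norm (blinfun_apply a (x n)) * norm (y n)"
    by (rule cmod_cinner_le)
  also have "\<dots> \<le> (C * norm (x n)) * norm (y n)"
    by (rule mult_right_mono[OF order_trans[OF norm_blinfun mult_right_mono[OF assms]]]) auto
  also have "\<dots> = C * (norm (x n) * norm (y n))" by simp
  also have "\<dots> \<le> C * ((norm (x n))\<^sup>2 + (norm (y n))\<^sup>2)"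
    using sum_squares_bound[of "norm (x n)" "norm (y n)"] \<open>C \<ge> 0\<close>
    by (intro mult_left_mono) (auto intro: order_trans[rotated])
  finally show ?thesis .
qed

lemma summable_normal_functional_bound:
  "\<lbrakk>square_summable x; square_summable y\<rbrakk> \<Longrightarrow> summable (\<lambda>n. C * ((norm (x n))\<^sup>2 + (norm (y n))\<^sup>2))"
  unfolding square_summable_def by (intro summable_mult summable_add)

lemma summable_normal_functional:
  assumes "square_summable x" "square_summable y"
  shows "summable (\<lambda>n. cinner (blinfun_apply a (x n)) (y n))"
  by (rule summable_comparison_test'[OF summable_normal_functional_bound[OF assms]])
    (rule normal_functional_term_bound[OF order_refl])

lemma normal_functional_add:
  assumes "square_summable x" "square_summable y" "a \<in> BH" "b \<in> BH"
  shows "normal_functional x y (a + b) = normal_functional x y a + normal_functional x y b"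
  using assms subspace_add[OF subspace_BH, of a b]
  by (simp add: normal_functional_def plus_blinfun.rep_eq cinner.add_left suminf_add summable_normal_functional)

lemma normal_functional_scaleR:
  assumes "square_summable x" "square_summable y" "a \<in> BH"
  shows "normal_functional x y (r *\<^sub>R a) = r *\<^sub>R normal_functional x y a"
  using assms subspace_scale[OF subspace_BH, of a r]
  by (simp add: normal_functional_def scaleR_blinfun.rep_eq cinner.scaleR_left suminf_scaleR_right
      summable_normal_functional)

text \<open>Real and imaginary parts reduce this to \<open>sums_if\<close> for real series.\<close>

lemma sums_interleave:
  fixes f g :: "nat \<Rightarrow> complex"
  assumes "f sums s" "g sums t"
  shows "(\<lambda>n. if even n then f (n div 2) else g ((n - 1) div 2)) sums (s + t)"
  unfolding sums_complex_iff
  using sums_if[OF sums_Re[OF assms(2)] sums_Re[OF assms(1)]]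
    sums_if[OF sums_Im[OF assms(2)] sums_Im[OF assms(1)]]
  by (simp add: if_distrib add.commute cong: if_cong)

text \<open>Merging the representing sequences of two normal functionals represents their sum; this
  makes the predual closed under addition.\<close>

definition interleave :: "(nat \<Rightarrow> 'b) \<Rightarrow> (nat \<Rightarrow> 'b) \<Rightarrow> nat \<Rightarrow> 'b" where
  "interleave f g n = (if even n then f (n div 2) else g ((n - 1) div 2))"

lemma square_summable_interleave:
  assumes "square_summable x" "square_summable y"
  shows "square_summable (interleave x y)"
  using sums_summable[OF sums_if[OF summable_sums summable_sums, OF assms(2,1)[unfolded square_summable_def]]]
  unfolding square_summable_def interleave_def by (simp add: if_distrib[of "\<lambda>z. (norm z)\<^sup>2"])

lemma normal_functional_interleave:
  assumes "square_summable x" "square_summable y" "square_summable x'" "square_summable y'" "a \<in> BH"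
  shows "normal_functional (interleave x x') (interleave y y') a
    = normal_functional x y a + normal_functional x' y' a"
proof -
  let ?s = "\<lambda>x y n. cinner (blinfun_apply a (x n)) (y n)"
  have "?s (interleave x x') (interleave y y')
    = (\<lambda>n. if even n then ?s x y (n div 2) else ?s x' y' ((n - 1) div 2))"
    by (auto simp: interleave_def)
  moreover have "\<dots> sums ((\<Sum>n. ?s x y n) + (\<Sum>n. ?s x' y' n))"
    using assms by (intro sums_interleave summable_sums summable_normal_functional)
  ultimately show ?thesis
    using \<open>a \<in> BH\<close> by (simp add: normal_functional_def sums_iff)
qed

lemma square_summable_scaleC: "square_summable x \<Longrightarrow> square_summable (\<lambda>n. c *\<^sub>C x n)"
  unfolding square_summable_def by (simp add: norm_scaleC power_mult_distrib summable_mult)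

lemma normal_functional_scaleC:
  assumes "square_summable x" "square_summable y" "a \<in> BH"
  shows "normal_functional (\<lambda>n. c *\<^sub>C x n) y a = c * normal_functional x y a"
proof -
  have "cinner (blinfun_apply a (c *\<^sub>C x n)) (y n) = c * cinner (blinfun_apply a (x n)) (y n)" for n
    using \<open>a \<in> BH\<close> by (simp add: BH_def cinner_scaleC_left)
  then show ?thesis
    using assms by (simp add: normal_functional_def suminf_mult summable_normal_functional)
qed

lemma predual_BH_combination:
  assumes "f \<in> predual_BH" "g \<in> predual_BH"
  shows "(\<lambda>a\<in>BH. s * f a + t * g a) \<in> predual_BH"
proof -
  obtain x y x' y' where
    f: "f = normal_functional x y" "square_summable x" "square_summable y" and
    g: "g = normal_functional x' y'" "square_summable x'" "square_summable y'"
    using assms unfolding predual_BH_eq by blast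
  have "(\<lambda>a\<in>BH. s * f a + t * g a)
    = normal_functional (interleave (\<lambda>n. s *\<^sub>C x n) (\<lambda>n. t *\<^sub>C x' n)) (interleave y y')"
  proof
    fix a
    show "(\<lambda>a\<in>BH. s * f a + t * g a) a
      = normal_functional (interleave (\<lambda>n. s *\<^sub>C x n) (\<lambda>n. t *\<^sub>C x' n)) (interleave y y') a"
    proof (cases "a \<in> BH")
      case True
      then show ?thesis
        using f g by (simp add: normal_functional_interleave normal_functional_scaleC square_summable_scaleC)
    qed (simp add: normal_functional_def)
  qed
  then show ?thesis
    unfolding predual_BH_eq using f g square_summable_interleave square_summable_scaleC by blast
qed

lemma matrix_coefficient_in_predual:
  "(\<lambda>a\<in>BH. cinner (blinfun_apply a u) v) \<in> predual_BH"
proof -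
  define x where "x n = (if n = 0 then u else 0)" for n :: nat
  define y where "y n = (if n = 0 then v else 0)" for n :: nat
  have sq: "square_summable x" "square_summable y"
    unfolding square_summable_def x_def y_def
    by (rule summable_finite[of "{0}"]; simp)+
  have "(\<Sum>n. cinner (blinfun_apply a (x n)) (y n)) = cinner (blinfun_apply a u) v" for a
    by (subst suminf_finite[of "{0}"]) (auto simp: x_def y_def cinner.zero_right)
  then have "(\<lambda>a\<in>BH. cinner (blinfun_apply a u) v) = normal_functional x y"
    unfolding normal_functional_def by simp
  then show ?thesis unfolding predual_BH_eq using sq by blast
qed

lemma functional_space_predual_BH: "functional_space BH predual_BH"
proof
  show "subspace BH" by (rule subspace_BH)
  show "predual_BH \<noteq> {}" using matrix_coefficient_in_predual by blast
  show "f \<in> extensional BH" if "f \<in> predual_BH" for f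
    using that unfolding predual_BH_def by auto
  show "f (a + b) = f a + f b" if "f \<in> predual_BH" "a \<in> BH" "b \<in> BH" for f and a b :: "'a \<Rightarrow>\<^sub>L 'a"
    using that normal_functional_add unfolding predual_BH_eq by blast
  show "f (r *\<^sub>R a) = r *\<^sub>R f a" if "f \<in> predual_BH" "a \<in> BH" for f r and a :: "'a \<Rightarrow>\<^sub>L 'a"
    using that normal_functional_scaleR unfolding predual_BH_eq by blast
qed (rule predual_BH_combination)

interpretation BH: functional_space BH predual_BH
  by (rule functional_space_predual_BH)

text \<open>Tannery's theorem, the dominated convergence theorem for series: the terms converge by
  \<open>lim\<close> and are dominated because the operators are norm bounded. Thus normal
  functionals are sequentially continuous for bounded weak operator convergence.\<close>

lemma predual_BH_tendsto:
  assumes "f \<in> predual_BH" and BH: "\<And>n. a n \<in> BH" "b \<in> BH" and C: "\<And>n. norm (a n) \<le> C"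
    and lim: "\<And>u v. (\<lambda>n. cinner (blinfun_apply (a n) u) v) \<longlonglongrightarrow> cinner (blinfun_apply b u) v"
  shows "(\<lambda>n. f (a n)) \<longlonglongrightarrow> f b"
proof -
  obtain x y where f: "f = normal_functional x y" and sq: "square_summable x" "square_summable y"
    using assms unfolding predual_BH_eq by blast
  have "(\<lambda>n. \<Sum>k. cinner (blinfun_apply (a n) (x k)) (y k)) \<longlonglongrightarrow> (\<Sum>k. cinner (blinfun_apply b (x k)) (y k))"
    by (rule tannerys_theorem[THEN conjunct2, THEN conjunct2,
          OF lim _ summable_normal_functional_bound[OF sq, of C]])
      (auto intro!: always_eventually normal_functional_term_bound C)
  then show ?thesis unfolding f normal_functional_def using BH by simp
qed

section \<open>Permutations and matrix units\<close>

locale orthonormal =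
  fixes e :: "nat \<Rightarrow> 'h::complex_hilbert_space"
  assumes basis: "orthonormal_basis e"
begin

lemma cinner_basis: "cinner (e m) (e n) = (if m = n then 1 else 0)"
  using basis by (simp add: orthonormal_basis_def)

lemma norm_basis: "norm (e n) = 1"
  by (simp add: norm_eq_sqrt_inner inner_eq_Re_cinner cinner_basis)

text \<open>The complex span of the basis is dense. This is the device for extending identities and
  limits from basis vectors to all vectors.\<close>

lemma closed_subspace_UNIV:
  assumes "closed S" and "\<And>n. e n \<in> S" and "\<And>x y. x \<in> S \<Longrightarrow> y \<in> S \<Longrightarrow> x + y \<in> S"
    and "\<And>c x. x \<in> S \<Longrightarrow> c *\<^sub>C x \<in> S"
  shows "x \<in> S"
proof -
  have "0 \<in> S" using assms(4)[OF assms(2), of 0] by (metis complex_vector.scale_zero_left)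
  then have "complex_vector.subspace S"
    using assms unfolding complex_vector.subspace_def by blast
  then have "cspan (range e) \<subseteq> S"
    using assms(2) by (intro complex_vector.span_minimal) auto
  then show ?thesis
    using basis closure_minimal[OF _ \<open>closed S\<close>] unfolding orthonormal_basis_def by blast
qed

lemma BH_eqI:
  assumes "a \<in> BH" "b \<in> BH" "\<And>n. blinfun_apply a (e n) = blinfun_apply b (e n)"
  shows "a = b"
proof (rule blinfun_eqI)
  fix x
  have "x \<in> {x. blinfun_apply a x = blinfun_apply b x}"
  proof (rule closed_subspace_UNIV)
    show "closed {x. blinfun_apply a x = blinfun_apply b x}"
      by (rule closed_Collect_eq) (intro continuous_intros)+
  qed (use assms in \<open>auto simp: blinfun.add_right BH_def\<close>)
  then show "blinfun_apply a x = blinfun_apply b x" by simp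
qed

definition matrix_unit :: "nat \<Rightarrow> nat \<Rightarrow> 'h \<Rightarrow>\<^sub>L 'h" where
  "matrix_unit k i = Blinfun (\<lambda>x. cinner x (e i) *\<^sub>C e k)"

lemma norm_matrix_unit_apply: "norm (cinner x (e i) *\<^sub>C e k) \<le> norm x"
  using cmod_cinner_le[of x "e i"] by (simp add: norm_scaleC norm_basis)

lemma matrix_unit_apply: "blinfun_apply (matrix_unit k i) x = cinner x (e i) *\<^sub>C e k"
proof -
  have "bounded_linear (\<lambda>x. cinner x (e i) *\<^sub>C e k)"
    by (rule bounded_linear_intro[where K = 1])
      (use norm_matrix_unit_apply in \<open>auto simp: cinner.add_left cinner_scaleC_left scaleC_add_left scaleR_scaleC
        scaleC_scaleC\<close>)
  then show ?thesis unfolding matrix_unit_def by (simp add: bounded_linear_Blinfun_apply)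
qed

lemma matrix_unit_basis: "blinfun_apply (matrix_unit k i) (e j) = (if i = j then e k else 0)"
  by (simp add: matrix_unit_apply cinner_basis)

lemma matrix_unit_BH: "matrix_unit k i \<in> BH"
  by (simp add: BH_def matrix_unit_apply cinner_scaleC_left scaleC_scaleC)

lemma norm_matrix_unit_le: "norm (matrix_unit k i) \<le> 1"
  by (rule norm_blinfun_bound) (use norm_matrix_unit_apply in \<open>auto simp: matrix_unit_apply\<close>)

definition projection :: "nat \<Rightarrow> 'h \<Rightarrow>\<^sub>L 'h" where
  "projection N = (\<Sum>i<N. matrix_unit i i)"

lemma projection_apply: "blinfun_apply (projection N) x = (\<Sum>i<N. cinner x (e i) *\<^sub>C e i)"
  by (simp add: projection_def blinfun.sum_left matrix_unit_apply)

lemma projection_BH: "projection N \<in> BH"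
  unfolding projection_def by (intro subspace_sum[OF subspace_BH] matrix_unit_BH)

lemma cinner_projection:
  "cinner (blinfun_apply (projection N) x) y = cinner x (blinfun_apply (projection N) y)"
  by (simp add: projection_apply cinner.sum_left cinner.sum_right cinner_scaleC_left cinner_scaleC_right
      mult.commute flip: cinner_commute)

lemma projection_basis: "blinfun_apply (projection N) (e j) = (if j < N then e j else 0)"
  by (simp add: projection_def blinfun.sum_left matrix_unit_basis sum.delta)

lemma projection_idem: "blinfun_apply (projection N) (blinfun_apply (projection N) x) = blinfun_apply (projection N) x"
proof -
  have "projection N o\<^sub>L projection N = projection N"
    by (rule BH_eqI) (auto simp: projection_BH BH_compose projection_basis)
  then show ?thesis by (metis blinfun_apply_blinfun_compose)
qed

text \<open>As the projection is self-adjoint and idempotent, the square of the norm of its value at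
  \<open>x\<close> equals the inner product of \<open>x\<close> with that value; Cauchy-Schwarz then
  allows cancelling one factor.\<close>

lemma norm_projection_apply_le: "norm (blinfun_apply (projection N) x) \<le> norm x"
proof -
  let ?p = "blinfun_apply (projection N) x"
  have "inner ?p ?p = inner x ?p"
    by (simp add: inner_eq_Re_cinner cinner_projection projection_idem)
  then have "norm ?p * norm ?p \<le> norm x * norm ?p"
    by (metis norm_cauchy_schwarz power2_norm_eq_inner power2_eq_square)
  then show ?thesis
    by (cases "norm ?p = 0") (auto simp: mult_le_cancel_right)
qed

lemma norm_projection_le: "norm (projection N) \<le> 1"
  by (rule norm_blinfun_bound) (use norm_projection_apply_le in auto)

text \<open>On a basis vector the sequence is eventually constant. The vectors at which convergence
  holds form a complex subspace, closed by an \<open>r / 3\<close> argument because all projections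
  are contractions.\<close>

lemma projection_tendsto: "(\<lambda>N. blinfun_apply (projection N) x) \<longlonglongrightarrow> x"
proof -
  define S where "S = {x. (\<lambda>N. blinfun_apply (projection N) x) \<longlonglongrightarrow> x}"
  have "x \<in> S"
  proof (rule closed_subspace_UNIV)
    show "closed S"
      unfolding closed_sequential_limits
    proof (intro allI impI)
      fix X x assume X: "(\<forall>n. X n \<in> S) \<and> X \<longlonglongrightarrow> x"
      show "x \<in> S"
        unfolding S_def mem_Collect_eq
      proof (rule LIMSEQ_I)
        fix r :: real assume "r > 0"
        then obtain n where n: "norm (X n - x) < r / 3"
          using X LIMSEQ_D[of X x "r / 3"] by auto
        have "(\<lambda>N. blinfun_apply (projection N) (X n)) \<longlonglongrightarrow> X n"
          using X unfolding S_def by blast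
        then obtain M where M: "\<And>N. N \<ge> M \<Longrightarrow> norm (blinfun_apply (projection N) (X n) - X n) < r / 3"
          using LIMSEQ_D[of _ "X n" "r / 3"] \<open>r > 0\<close> by fastforce
        have "norm (blinfun_apply (projection N) x - x) < r" if "N \<ge> M" for N
        proof -
          have "blinfun_apply (projection N) x - x = blinfun_apply (projection N) (x - X n)
              + (blinfun_apply (projection N) (X n) - X n) + (X n - x)"
            by (simp add: blinfun.diff_right)
          also have "norm \<dots> \<le> norm (x - X n) + norm (blinfun_apply (projection N) (X n) - X n) + norm (X n - x)"
            using norm_projection_apply_le by (intro norm_triangle_mono) auto
          also have "\<dots> < r" using n M[OF that] by (simp add: norm_minus_commute)
          finally show ?thesis .
        qed
        then show "\<exists>M. \<forall>N\<ge>M. norm (blinfun_apply (projection N) x - x) < r" by blast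
      qed
    qed
    show "e n \<in> S" for n
      unfolding S_def mem_Collect_eq projection_basis
      by (intro tendsto_eventually eventually_sequentiallyI[of "Suc n"]) simp
    show "x + y \<in> S" if "x \<in> S" "y \<in> S" for x y
      using that unfolding S_def by (auto simp: blinfun.add_right intro: tendsto_add)
    show "c *\<^sub>C x \<in> S" if "x \<in> S" for c x
    proof -
      have "norm (blinfun_apply (projection N) (c *\<^sub>C x) - c *\<^sub>C x)
          = cmod c * norm (blinfun_apply (projection N) x - x)" for N
        using projection_BH
        by (metis (mono_tags, lifting) BH_def complex_vector.scale_right_diff_distrib mem_Collect_eq norm_scaleC)
      moreover have "(\<lambda>N. cmod c * norm (blinfun_apply (projection N) x - x)) \<longlonglongrightarrow> 0"
        using that unfolding S_def by (intro tendsto_mult_right_zero tendsto_norm_zero) (simp add: LIM_zero)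
      ultimately have "(\<lambda>N. norm (blinfun_apply (projection N) (c *\<^sub>C x) - c *\<^sub>C x)) \<longlonglongrightarrow> 0"
        by simp
      then show ?thesis
        unfolding S_def mem_Collect_eq by (rule LIM_zero_cancel[OF tendsto_norm_zero_cancel])
    qed
  qed
  then show ?thesis unfolding S_def by simp
qed

text \<open>The \<open>k\<close>-th term of the expansion of \<open>x\<close> is the difference of
  two consecutive partial sums, both of which converge to \<open>x\<close>.\<close>

lemma cinner_basis_tendsto_0: "(\<lambda>k. cinner x (e k)) \<longlonglongrightarrow> 0"
proof -
  have "(\<lambda>k. blinfun_apply (projection (Suc k)) x - blinfun_apply (projection k) x) \<longlonglongrightarrow> x - x"
    by (intro tendsto_diff projection_tendsto LIMSEQ_Suc)
  then have "(\<lambda>k. norm (cinner x (e k) *\<^sub>C e k)) \<longlonglongrightarrow> 0"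
    by (intro tendsto_norm_zero) (simp add: projection_apply)
  then show ?thesis by (simp add: norm_scaleC norm_basis tendsto_norm_zero_iff)
qed

text \<open>The coefficient of \<open>matrix_unit k i\<close> at \<open>u\<close>, \<open>v\<close>
  is \<open>cinner u (e i) * cinner (e k) v\<close>, which tends to 0 as either index grows, and the
  norms are at most 1.\<close>

lemma predual_matrix_unit_tendsto_0:
  assumes "f \<in> predual_BH"
  shows "(\<lambda>i. f (matrix_unit k i)) \<longlonglongrightarrow> 0" "(\<lambda>k. f (matrix_unit k i)) \<longlonglongrightarrow> 0"
proof -
  have zero: "f 0 = 0" "0 \<in> BH" using BH.zero[OF assms] subspace_0[OF subspace_BH] .
  have col: "(\<lambda>i. cinner u (e i) * cinner (e k) v) \<longlonglongrightarrow> 0" for u v k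
    by (rule tendsto_mult_left_zero[OF cinner_basis_tendsto_0])
  have row: "(\<lambda>k. cinner u (e i) * cinner (e k) v) \<longlonglongrightarrow> 0" for u v i
    using tendsto_cnj[OF cinner_basis_tendsto_0[of v]] cinner_commute[of _ v]
    by (intro tendsto_mult_right_zero) simp
  show "(\<lambda>i. f (matrix_unit k i)) \<longlonglongrightarrow> 0"
    using predual_BH_tendsto[OF assms matrix_unit_BH zero(2) norm_matrix_unit_le, of "\<lambda>_. k" "\<lambda>i. i"] col
    by (simp add: zero matrix_unit_apply cinner_scaleC_left cinner.zero_left)
  show "(\<lambda>k. f (matrix_unit k i)) \<longlonglongrightarrow> 0"
    using predual_BH_tendsto[OF assms matrix_unit_BH zero(2) norm_matrix_unit_le, of "\<lambda>k. k" "\<lambda>_. i"] row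
    by (simp add: zero matrix_unit_apply cinner_scaleC_left cinner.zero_left)
qed

lemma perm_op_exists:
  assumes "\<rho> \<in> FS"
  shows "\<exists>a\<in>BH. \<forall>n. blinfun_apply a (e n) = e (\<rho> n)"
proof -
  define F where "F = {n. \<rho> n \<noteq> n}"
  have "finite F" using assms by (simp add: FS_def F_def)
  \<comment> \<open>Only finitely many basis vectors move, so the operator is a finite rank
    perturbation of the identity and its boundedness is immediate.\<close>
  define a where "a = id_blinfun + (\<Sum>i\<in>F. matrix_unit (\<rho> i) i - matrix_unit i i)"
  have "id_blinfun \<in> BH" by (simp add: BH_def)
  then have "a \<in> BH"
    unfolding a_def
    by (intro subspace_add[OF subspace_BH] subspace_sum[OF subspace_BH] subspace_diff[OF subspace_BH] matrix_unit_BH)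
  moreover have "blinfun_apply a (e n) = e (\<rho> n)" for n
  proof -
    have "blinfun_apply a (e n) = e n + (\<Sum>i\<in>F. if i = n then e (\<rho> n) - e n else 0)"
      unfolding a_def
      by (simp add: plus_blinfun.rep_eq blinfun.sum_left minus_blinfun.rep_eq matrix_unit_basis)
        (auto intro!: sum.cong)
    also have "\<dots> = e (\<rho> n)" using \<open>finite F\<close> by (auto simp: F_def)
    finally show ?thesis .
  qed
  ultimately show ?thesis by blast
qed

lemma perm_op:
  assumes "\<rho> \<in> FS"
  shows "perm_op e \<rho> \<in> BH" "blinfun_apply (perm_op e \<rho>) (e n) = e (\<rho> n)"
proof -
  have "\<exists>!a. a \<in> BH \<and> (\<forall>n. blinfun_apply a (e n) = e (\<rho> n))"
    using perm_op_exists[OF assms] BH_eqI by metis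
  from theI'[OF this] show "perm_op e \<rho> \<in> BH" "blinfun_apply (perm_op e \<rho>) (e n) = e (\<rho> n)"
    unfolding perm_op_def by blast+
qed

section \<open>Operators with real matrix coefficients form a closed real subspace\<close>

lemma subspace_BH_real: "subspace (BH_real e)"
  using subspace_BH
  by (auto simp: subspace_def BH_real_def plus_blinfun.rep_eq scaleR_blinfun.rep_eq zero_blinfun.rep_eq
      cinner.add_left cinner.scaleR_left cinner.zero_left scaleR_conv_of_real)

lemma affine_hull_subset_BH_real: "affine hull (perm_op e ` FS) \<subseteq> BH_real e"
proof (rule hull_minimal)
  show "perm_op e ` FS \<subseteq> BH_real e"
    unfolding BH_real_def using perm_op by (auto simp: cinner_basis)
  show "affine (BH_real e)" by (rule subspace_imp_affine[OF subspace_BH_real])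
qed

lemma closedin_BH_real: "closedin arens_mackey (BH_real e)"
proof -
  define f where "f m k = (\<lambda>a\<in>BH. cinner (blinfun_apply a (e k)) (e m))" for m k
  have "BH_real e = (\<Inter>(m, k)\<in>UNIV. {a \<in> topspace arens_mackey. f m k a \<in> \<real>})"
    unfolding BH_real_def arens_mackey_def BH.topspace_mackey f_def by auto
  moreover have "closedin arens_mackey {a \<in> topspace arens_mackey. f m k a \<in> \<real>}" for m k
    unfolding arens_mackey_def f_def
    by (rule closedin_continuous_map_preimage[OF BH.continuous_map_mackey[OF matrix_coefficient_in_predual]])
      (simp add: closed_complex_Reals)
  ultimately show ?thesis by (auto intro!: closedin_Inter)
qed

section \<open>Finitely supported permutations and the exchange relation\<close>

lemma transpose_FS: "Transposition.transpose i j \<in> FS"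
proof -
  have "{n. Transposition.transpose i j n \<noteq> n} \<subseteq> {i, j}" by (auto simp: Transposition.transpose_def)
  then show ?thesis unfolding FS_def using finite_subset by auto
qed

lemma FS_compose:
  assumes "\<rho> \<in> FS" "\<sigma> \<in> FS"
  shows "\<rho> \<circ> \<sigma> \<in> FS"
proof -
  have "{n. (\<rho> \<circ> \<sigma>) n \<noteq> n} \<subseteq> {n. \<rho> n \<noteq> n} \<union> {n. \<sigma> n \<noteq> n}" by auto
  then show ?thesis using assms finite_subset unfolding FS_def by (auto intro: bij_comp)
qed

lemma FS_two_point:
  assumes "i \<noteq> j" "k \<noteq> l"
  obtains \<rho> where "\<rho> \<in> FS" "\<rho> i = k" "\<rho> j = l"
proof
  \<comment> \<open>\<open>j'\<close> is where the first transposition moves \<open>j\<close>; it is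
    not \<open>k\<close>, which is already the image of \<open>i\<close>. The second transposition
    sends \<open>j'\<close> to \<open>l\<close> and leaves \<open>k\<close> fixed.\<close>
  define j' where "j' = Transposition.transpose i k j"
  have "j' \<noteq> k" using \<open>i \<noteq> j\<close> by (auto simp: j'_def Transposition.transpose_def)
  let ?\<rho> = "Transposition.transpose j' l \<circ> Transposition.transpose i k"
  show "?\<rho> \<in> FS" by (intro FS_compose transpose_FS)
  show "?\<rho> i = k" using \<open>j' \<noteq> k\<close> \<open>k \<noteq> l\<close> by simp
  show "?\<rho> j = l" by (simp flip: j'_def)
qed

lemma matrix_unit_exchange:
  assumes "i \<noteq> j" "k \<noteq> l"
  obtains \<rho> \<sigma> where "\<rho> \<in> FS" "\<sigma> \<in> FS"
    "matrix_unit k i + matrix_unit l j - (matrix_unit l i + matrix_unit k j) = perm_op e \<rho> - perm_op e \<sigma>"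
proof -
  obtain \<rho> where \<rho>: "\<rho> \<in> FS" "\<rho> i = k" "\<rho> j = l" using FS_two_point[OF assms] .
  \<comment> \<open>This permutation sends \<open>i\<close> to \<open>l\<close> and \<open>j\<close>
    to \<open>k\<close> and agrees with \<open>\<rho>\<close> elsewhere, so only four matrix units
    survive in the difference.\<close>
  let ?\<sigma> = "\<rho> \<circ> Transposition.transpose i j"
  have \<sigma>: "?\<sigma> \<in> FS" by (intro FS_compose transpose_FS \<rho>)
  have "matrix_unit k i + matrix_unit l j - (matrix_unit l i + matrix_unit k j) = perm_op e \<rho> - perm_op e ?\<sigma>"
  proof (rule BH_eqI)
    show "matrix_unit k i + matrix_unit l j - (matrix_unit l i + matrix_unit k j) \<in> BH"
      by (intro subspace_add[OF subspace_BH] subspace_diff[OF subspace_BH] matrix_unit_BH)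
    show "perm_op e \<rho> - perm_op e ?\<sigma> \<in> BH"
      by (intro subspace_diff[OF subspace_BH] perm_op \<rho> \<sigma>)
    show "blinfun_apply (matrix_unit k i + matrix_unit l j - (matrix_unit l i + matrix_unit k j)) (e n)
      = blinfun_apply (perm_op e \<rho> - perm_op e ?\<sigma>) (e n)" for n
      using \<rho> assms
      by (auto simp: plus_blinfun.rep_eq minus_blinfun.rep_eq matrix_unit_basis perm_op \<sigma> Transposition.transpose_def)
  qed
  then show thesis using that \<rho> \<sigma> by blast
qed

text \<open>The exchange relation says that \<open>\<tau> k i - \<tau> k j\<close> does not depend
  on \<open>k\<close>. Moving the row index to infinity makes this difference 0, so every row is
  constant, and a constant row that tends to 0 vanishes.\<close>

lemma Re_matrix_unit_eq_0:
  assumes f: "f \<in> predual_BH"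
    and const: "\<And>\<rho> \<sigma>. \<rho> \<in> FS \<Longrightarrow> \<sigma> \<in> FS \<Longrightarrow> Re (f (perm_op e \<rho>)) = Re (f (perm_op e \<sigma>))"
  shows "Re (f (matrix_unit k i)) = 0"
proof -
  define \<tau> where "\<tau> k i = Re (f (matrix_unit k i))" for k i
  have exchange: "\<tau> k i + \<tau> l j = \<tau> l i + \<tau> k j" if ne: "i \<noteq> j" "k \<noteq> l" for i j k l
  proof -
    obtain \<rho> \<sigma> where \<rho>\<sigma>: "\<rho> \<in> FS" "\<sigma> \<in> FS"
      "matrix_unit k i + matrix_unit l j - (matrix_unit l i + matrix_unit k j) = perm_op e \<rho> - perm_op e \<sigma>"
      using matrix_unit_exchange[OF ne] .
    have "f (matrix_unit k i + matrix_unit l j - (matrix_unit l i + matrix_unit k j))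
      = f (matrix_unit k i) + f (matrix_unit l j) - (f (matrix_unit l i) + f (matrix_unit k j))"
      by (simp add: BH.diff[OF f] BH.add[OF f] matrix_unit_BH subspace_add[OF subspace_BH])
    then have "f (perm_op e \<rho>) - f (perm_op e \<sigma>)
      = f (matrix_unit k i) + f (matrix_unit l j) - (f (matrix_unit l i) + f (matrix_unit k j))"
      unfolding \<rho>\<sigma>(3) using BH.diff[OF f perm_op(1) perm_op(1), OF \<rho>\<sigma>(1,2)] by simp
    from arg_cong[OF this, of Re]
    have "Re (f (perm_op e \<rho>)) - Re (f (perm_op e \<sigma>)) = \<tau> k i + \<tau> l j - (\<tau> l i + \<tau> k j)"
      by (simp add: \<tau>_def)
    then show ?thesis using const[OF \<rho>\<sigma>(1,2)] by simp
  qed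
  have lim: "(\<lambda>i. \<tau> k i) \<longlonglongrightarrow> 0" "(\<lambda>k. \<tau> k i) \<longlonglongrightarrow> 0" for k i
    unfolding \<tau>_def using tendsto_Re[OF predual_matrix_unit_tendsto_0(1)[OF f]]
      tendsto_Re[OF predual_matrix_unit_tendsto_0(2)[OF f]] by auto
  have eq: "\<tau> k i = \<tau> k j" if "i \<noteq> j" for k i j
  proof -
    have "(\<lambda>l. \<tau> l i + \<tau> k j - \<tau> l j) \<longlonglongrightarrow> 0 + \<tau> k j - 0"
      by (intro tendsto_intros lim)
    \<comment> \<open>Starting at \<open>Suc k\<close> guarantees \<open>k \<noteq> l\<close>, as
      the exchange relation requires.\<close>
    moreover have "\<forall>\<^sub>F l in sequentially. \<tau> l i + \<tau> k j - \<tau> l j = \<tau> k i"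
      using exchange[OF that] by (intro eventually_sequentiallyI[of "Suc k"]) (simp add: algebra_simps)
    ultimately have "(\<lambda>l. \<tau> k i) \<longlonglongrightarrow> \<tau> k j"
      by (simp add: tendsto_cong)
    then show ?thesis by (simp add: LIMSEQ_const_iff)
  qed
  have "\<forall>\<^sub>F j in sequentially. \<tau> k j = \<tau> k i"
    using eq by (intro always_eventually) metis
  then have "(\<lambda>j. \<tau> k i) \<longlonglongrightarrow> 0" using lim(1)[of k] by (simp add: tendsto_cong)
  then show ?thesis by (simp add: LIMSEQ_const_iff \<tau>_def)
qed

section \<open>Compression to finitely many basis vectors\<close>

lemma compression_eq:
  assumes "a \<in> BH_real e"
  shows "projection N o\<^sub>L a o\<^sub>L projection N
    = (\<Sum>i<N. \<Sum>k<N. Re (cinner (blinfun_apply a (e i)) (e k)) *\<^sub>R matrix_unit k i)"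
proof (rule BH_eqI)
  have "a \<in> BH" using assms BH_real_def by blast
  then show "projection N o\<^sub>L a o\<^sub>L projection N \<in> BH"
    by (intro BH_compose projection_BH)
  show "(\<Sum>i<N. \<Sum>k<N. Re (cinner (blinfun_apply a (e i)) (e k)) *\<^sub>R matrix_unit k i) \<in> BH"
    by (intro subspace_sum[OF subspace_BH] subspace_scale[OF subspace_BH] matrix_unit_BH)
  fix n
  \<comment> \<open>Here the reality of the coefficients enters: the compression becomes a
    combination of matrix units with real scalars.\<close>
  have real: "complex_of_real (Re (cinner (blinfun_apply a (e i)) (e k))) = cinner (blinfun_apply a (e i)) (e k)" for i k
    using assms unfolding BH_real_def by (simp add: of_real_Re)
  have "blinfun_apply (\<Sum>i<N. \<Sum>k<N. Re (cinner (blinfun_apply a (e i)) (e k)) *\<^sub>R matrix_unit k i) (e n)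
    = (\<Sum>i<N. if i = n then \<Sum>k<N. cinner (blinfun_apply a (e n)) (e k) *\<^sub>C e k else 0)"
    unfolding blinfun.sum_left
  proof (rule sum.cong)
    show "(\<Sum>k<N. blinfun_apply (Re (cinner (blinfun_apply a (e i)) (e k)) *\<^sub>R matrix_unit k i) (e n))
      = (if i = n then \<Sum>k<N. cinner (blinfun_apply a (e n)) (e k) *\<^sub>C e k else 0)" for i
      by (cases "i = n") (simp_all add: scaleR_blinfun.rep_eq matrix_unit_basis scaleR_scaleC real)
  qed simp
  also have "\<dots> = blinfun_apply (projection N) (blinfun_apply a (if n < N then e n else 0))"
    by (simp add: projection_apply blinfun.zero_right cinner.zero_left)
  also have "\<dots> = blinfun_apply (projection N o\<^sub>L a o\<^sub>L projection N) (e n)"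
    by (simp add: projection_basis)
  finally show "blinfun_apply (projection N o\<^sub>L a o\<^sub>L projection N) (e n)
    = blinfun_apply (\<Sum>i<N. \<Sum>k<N. Re (cinner (blinfun_apply a (e i)) (e k)) *\<^sub>R matrix_unit k i) (e n)" ..
qed

text \<open>Self-adjointness moves the left projection onto \<open>v\<close>; both arguments then
  converge in norm, and the compressions are bounded by \<open>norm a\<close>.\<close>

lemma compression_tendsto:
  assumes "f \<in> predual_BH" "a \<in> BH"
  shows "(\<lambda>N. f (projection N o\<^sub>L a o\<^sub>L projection N)) \<longlonglongrightarrow> f a"
proof (rule predual_BH_tendsto[OF assms(1)])
  show "projection N o\<^sub>L a o\<^sub>L projection N \<in> BH" for N
    using assms by (intro BH_compose projection_BH)
  show "norm (projection N o\<^sub>L a o\<^sub>L projection N) \<le> norm a" for N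
  proof -
    have "norm (projection N o\<^sub>L a o\<^sub>L projection N) \<le> (1 * norm a) * 1"
      by (intro order_trans[OF norm_blinfun_compose] mult_mono norm_projection_le) auto
    then show ?thesis by simp
  qed
  show "(\<lambda>N. cinner (blinfun_apply (projection N o\<^sub>L a o\<^sub>L projection N) u) v) \<longlonglongrightarrow> cinner (blinfun_apply a u) v" for u v
    by (simp add: cinner_projection)
      (intro cinner.tendsto blinfun.tendsto tendsto_const projection_tendsto)
qed fact

lemma Re_eq_0_on_BH_real:
  assumes f: "f \<in> predual_BH"
    and const: "\<And>\<rho> \<sigma>. \<rho> \<in> FS \<Longrightarrow> \<sigma> \<in> FS \<Longrightarrow> Re (f (perm_op e \<rho>)) = Re (f (perm_op e \<sigma>))"
    and a: "a \<in> BH_real e"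
  shows "Re (f a) = 0"
proof -
  \<comment> \<open>As only the real part of \<open>f\<close> is controlled, \<open>K\<close> is a
    real subspace, which is enough because the compressions of \<open>a\<close> are real
    combinations of matrix units.\<close>
  define K where "K = {b \<in> BH. Re (f b) = 0}"
  have "subspace K"
    unfolding K_def subspace_def using BH.zero[OF f] BH.add[OF f] BH.scale[OF f] subspace_BH
    by (auto simp: subspace_def)
  moreover have "matrix_unit k i \<in> K" for k i
    by (simp add: K_def matrix_unit_BH Re_matrix_unit_eq_0[OF f const])
  ultimately have "projection N o\<^sub>L a o\<^sub>L projection N \<in> K" for N
    unfolding compression_eq[OF a] by (intro subspace_sum subspace_scale)
  then have "(\<lambda>N. Re (f (projection N o\<^sub>L a o\<^sub>L projection N))) = (\<lambda>N. 0)"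
    unfolding K_def by auto
  moreover have "a \<in> BH" using a BH_real_def by blast
  ultimately show ?thesis
    using tendsto_Re[OF compression_tendsto[OF f \<open>a \<in> BH\<close>]] by (simp add: LIMSEQ_const_iff)
qed

end

theorem proposition3p5:
  fixes e :: "nat \<Rightarrow> 'h::complex_hilbert_space"
  assumes "orthonormal_basis e"
  shows "arens_mackey closure_of (affine hull (perm_op e ` FS)) = BH_real e"
proof
  interpret orthonormal e by standard (rule assms)
  let ?A = "affine hull (perm_op e ` FS)"
  show "arens_mackey closure_of ?A \<subseteq> BH_real e"
    by (rule closure_of_minimal[OF affine_hull_subset_BH_real closedin_BH_real])
  have id: "id \<in> FS" by (simp add: FS_def)
  have hull: "perm_op e \<rho> \<in> ?A" if "\<rho> \<in> FS" for \<rho> using that by (simp add: hull_inc)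
  show "BH_real e \<subseteq> arens_mackey closure_of ?A"
  proof (rule subsetI, rule ccontr)
    fix a assume a: "a \<in> BH_real e" and notin: "a \<notin> arens_mackey closure_of ?A"
    obtain f where f: "f \<in> predual_BH" and ne: "\<And>b. b \<in> ?A \<Longrightarrow> Re (f b) \<noteq> Re (f a)"
      and const: "\<And>b c. b \<in> ?A \<Longrightarrow> c \<in> ?A \<Longrightarrow> Re (f b) = Re (f c)"
    proof (rule BH.mackey_separation)
      show "affine ?A" by (rule affine_affine_hull)
      show "?A \<subseteq> BH" using affine_hull_subset_BH_real BH_real_def by blast
      show "?A \<noteq> {}" using hull[OF id] by blast
      show "a \<in> BH" using a BH_real_def by blast
      show "a \<notin> mackey_topology BH predual_BH closure_of ?A" using notin by (simp add: arens_mackey_def)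
    qed blast
    \<comment> \<open>This applies both to \<open>a\<close> and to the operator of the identity
      permutation, where \<open>ne\<close> demands different values.\<close>
    have "Re (f b) = 0" if "b \<in> BH_real e" for b
      by (rule Re_eq_0_on_BH_real[OF f const that]) (use hull in auto)
    then show False
      using ne[OF hull[OF id]] a hull[OF id] affine_hull_subset_BH_real by auto
  qed
qed

end
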